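(* For every integer $k\ge 1$, the quantity $$\frac{k!\,(k+1)!}{n+1}\,F(n+2k;\,n,\,0),$$ as a function of the integer $n\ge 0$, is given by a polynomial in $n$ with all coefficients integers and with leading term $n^{2k-1}$.
   Context: For integers $m\ge 0$ and $n_1,n_2$, $F(m;n_1,n_2)$ denotes the number of Gessel walks with exactly $m$ steps from $(0,0)$ to $(n_1,n_2)$: lattice walks starting at the origin, each of whose $m$ steps is one of West $(-1,0)$, North-East $(1,1)$, East $(1,0)$, South-West $(-1,-1)$, and which remain in the first quadrant $\{(i,j): i\ge 0, j\ge 0\}$. In particular $F(m;n_1,n_2)=0$ if $n_1<0$ or $n_2<0$, and $F(0;n_1,n_2)=1$ if $n_1=n_2=0$ and $0$ otherwise. *)

theory Defs
  imports Complex_Main "HOL-Computational_Algebra.Polynomial"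
begin

definition gessel_steps :: "(int \<times> int) set" where
  "gessel_steps = {(-1, 0), (1, 1), (1, 0), (-1, -1)}"

text \<open>A walk is represented by its list of steps; the position after the first \<open>t\<close> steps
  is the sum of these steps.\<close>

definition position :: "(int \<times> int) list \<Rightarrow> nat \<Rightarrow> int \<times> int" where
  "position w t = (sum_list (map fst (take t w)), sum_list (map snd (take t w)))"

definition first_quadrant :: "(int \<times> int) set" where
  "first_quadrant = {(i, j). 0 \<le> i \<and> 0 \<le> j}"

definition gessel_walks :: "nat \<Rightarrow> int \<Rightarrow> int \<Rightarrow> (int \<times> int) list set" where
  "gessel_walks m n1 n2 =
     {w. length w = m \<and> set w \<subseteq> gessel_steps \<and>
         (\<forall>t\<le>m. position w t \<in> first_quadrant) \<and> position w m = (n1, n2)}"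

definition F :: "nat \<Rightarrow> int \<Rightarrow> int \<Rightarrow> nat" where
  "F m n1 n2 = card (gessel_walks m n1 n2)"

end

theory Submission
  imports Defs
begin

text \<open>
  Reflecting in the line \<open>j = -1\<close> along the direction that preserves the step set sends
  \<open>(n, j)\<close> to \<open>(n - 2j - 2, -j - 2)\<close>. The difference \<open>D\<close> of \<open>F\<close> and its reflection therefore
  satisfies the Gessel recurrence on the whole half plane \<open>n \<ge> 0\<close>, where it can be solved
  explicitly: the horizontal coordinate contributes ballot numbers and the vertical one binomial
  coefficients. The boundary values on the column \<open>n = -1\<close>, after \<open>2s - 1\<close> steps, are minus the
  numbers \<open>F(2s-1; 2i-3, i-2)\<close> in row \<open>-i\<close>, which vanish unless \<open>2 \<le> i \<le> s + 1\<close>.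
  This bound on \<open>i\<close> keeps the lower index of every binomial coefficient in the resulting formula for
  \<open>F(n+2k; n, 0)\<close> at most \<open>k + 1\<close>, and the ballot numbers need only a factor \<open>k!\<close>. The leading
  coefficient is \<open>(k + 1) - k\<close>, from the unreflected term and the term \<open>s = 1\<close>.
\<close>

section \<open>Recurrence and vanishing of the walk counts\<close>

lemma gessel_walks_zero:
  "gessel_walks 0 a b = (if a = 0 \<and> b = 0 then {[]} else {})"
  by (auto simp: gessel_walks_def position_def first_quadrant_def)

lemma finite_gessel_walks: "finite (gessel_walks m a b)"
proof (rule finite_subset)
  show "gessel_walks m a b \<subseteq> {w. set w \<subseteq> gessel_steps \<and> length w = m}"
    by (auto simp: gessel_walks_def)
  show "finite {w. set w \<subseteq> gessel_steps \<and> length w = m}"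
    by (rule finite_lists_length_eq) (simp add: gessel_steps_def)
qed

lemma gessel_walks_outside: "a < 0 \<or> b < 0 \<Longrightarrow> gessel_walks m a b = {}"
  by (auto simp: gessel_walks_def first_quadrant_def)

lemma gessel_walks_snoc_iff:
  assumes "0 \<le> a" "0 \<le> b"
  shows "w @ [s] \<in> gessel_walks (Suc m) a b \<longleftrightarrow>
    s \<in> gessel_steps \<and> w \<in> gessel_walks m (a - fst s) (b - snd s)"
  using assms
  by (auto simp: gessel_walks_def position_def first_quadrant_def le_Suc_eq)

lemma gessel_walks_Suc:
  assumes "0 \<le> a" "0 \<le> b"
  shows "gessel_walks (Suc m) a b =
    (\<Union>s\<in>gessel_steps. (\<lambda>w. w @ [s]) ` gessel_walks m (a - fst s) (b - snd s))"
proof (intro equalityI subsetI)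
  fix v assume v: "v \<in> gessel_walks (Suc m) a b"
  then have "v \<noteq> []" by (auto simp: gessel_walks_def)
  then obtain w s where "v = w @ [s]" by (metis append_butlast_last_id)
  with v show "v \<in> (\<Union>s\<in>gessel_steps. (\<lambda>w. w @ [s]) ` gessel_walks m (a - fst s) (b - snd s))"
    using gessel_walks_snoc_iff[OF assms] by auto
qed (use gessel_walks_snoc_iff[OF assms] in auto)

lemma F_zero: "F 0 a b = (if a = 0 \<and> b = 0 then 1 else 0)"
  by (simp add: F_def gessel_walks_zero)

lemma F_outside: "a < 0 \<or> b < 0 \<Longrightarrow> F m a b = 0"
  by (simp add: F_def gessel_walks_outside)

lemma F_Suc:
  assumes "0 \<le> a" "0 \<le> b"
  shows "F (Suc m) a b =
    F m (a + 1) b + F m (a - 1) (b - 1) + F m (a - 1) b + F m (a + 1) (b + 1)"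
proof -
  have "F (Suc m) a b =
      (\<Sum>s\<in>gessel_steps. card ((\<lambda>w. w @ [s]) ` gessel_walks m (a - fst s) (b - snd s)))"
    unfolding F_def gessel_walks_Suc[OF assms]
    by (rule card_UN_disjoint) (auto simp: finite_gessel_walks gessel_steps_def)
  also have "\<dots> = (\<Sum>s\<in>gessel_steps. F m (a - fst s) (b - snd s))"
    unfolding F_def by (intro sum.cong refl card_image) (auto simp: inj_on_def)
  finally show ?thesis by (simp add: gessel_steps_def)
qed

text \<open>Each step moves the horizontal coordinate by exactly one.\<close>

lemma F_far: "int m < a \<Longrightarrow> F m a b = 0"
proof (induction m arbitrary: a b)
  case (Suc m)
  then show ?case
    by (cases "0 \<le> b") (auto simp: F_Suc F_outside)
qed (simp add: F_zero)

section \<open>Antisymmetrization in the line \<open>j = -1\<close>\<close>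

definition D :: "nat \<Rightarrow> int \<Rightarrow> int \<Rightarrow> int" where
  "D m n j = int (F m n j) - int (F m (n - 2 * j - 2) (- j - 2))"

text \<open>The reflection fixes East and West and swaps North-East with South-West, so off row -1
  the mirrored count obeys the same recurrence.\<close>

lemma D_Suc:
  assumes "0 \<le> n"
  shows "D (Suc m) n j =
    D m (n + 1) j + D m (n - 1) (j - 1) + D m (n - 1) j + D m (n + 1) (j + 1)"
proof -
  consider "0 \<le> j" | "j = -1" | "j \<le> -2" by linarith
  then show ?thesis
  proof cases
    case 1
    then show ?thesis using assms by (simp add: D_def F_Suc F_outside)
  next
    case 2
    \<comment> \<open>Row -1 is its own mirror image, so \<open>D\<close> is 0 there, and the
      contributions of rows 0 and -2 cancel.\<close>
    then show ?thesis using assms by (simp add: D_def F_outside add.commute)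
  next
    case 3
    have "F (Suc m) (n - 2 * j - 2) (- j - 2) =
        F m (n - 2 * j - 2 + 1) (- j - 2) + F m (n - 2 * j - 2 - 1) (- j - 2 - 1) +
        F m (n - 2 * j - 2 - 1) (- j - 2) + F m (n - 2 * j - 2 + 1) (- j - 2 + 1)"
      using assms 3 by (intro F_Suc) auto
    moreover have "n + 1 - 2 * j - 2 = n - 2 * j - 2 + 1" "n - 1 - 2 * j - 2 = n - 2 * j - 2 - 1"
      "n - 1 - 2 * (j - 1) - 2 = n - 2 * j - 2 + 1" "n + 1 - 2 * (j + 1) - 2 = n - 2 * j - 2 - 1"
      "- (j - 1) - 2 = - j - 2 + 1" "- (j + 1) - 2 = - j - 2 - 1"
      by simp_all
    ultimately show ?thesis using 3 by (simp only: D_def) (simp add: F_outside)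
  qed
qed

definition zchoose :: "nat \<Rightarrow> int \<Rightarrow> int" where
  "zchoose N z = (if z < 0 then 0 else int (N choose nat z))"

lemma zchoose_Suc: "zchoose (Suc N) z = zchoose N z + zchoose N (z - 1)"
proof (cases "z \<le> 0")
  case False
  then have "nat z = Suc (nat (z - 1))" by simp
  then show ?thesis using False by (simp add: zchoose_def)
qed (auto simp: zchoose_def)

lemma zchoose_zero: "zchoose 0 z = (if z = 0 then 1 else 0)"
  by (auto simp: zchoose_def)

lemma zchoose_of_nat: "zchoose N (int i) = int (N choose i)"
  by (simp add: zchoose_def)

text \<open>Column \<open>h\<close> is reached in \<open>h\<close> steps only by East and North-East
  steps, and \<open>j\<close> of them must be North-East.\<close>

lemma D_diagonal: "D h (int h) j = zchoose h j"
proof (induction h arbitrary: j)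
  case 0
  then show ?case by (simp add: D_def F_zero zchoose_zero)
next
  case (Suc h)
  have far: "D h (int (Suc h) + 1) i = 0" for i
    by (cases "i \<le> -2") (auto simp: D_def F_far F_outside)
  have "D (Suc h) (int (Suc h)) j = D h (int h) (j - 1) + D h (int h) j"
    by (subst D_Suc) (simp_all only: far, simp_all)
  then show ?case using Suc.IH by (simp add: zchoose_Suc)
qed

section \<open>Explicit solution on the half plane\<close>

text \<open>The coefficient of \<open>s^r\<close> in the \<open>h\<close>-th power of the Catalan series \<open>C = 1 + s C^2\<close>.\<close>

function ballot :: "nat \<Rightarrow> nat \<Rightarrow> int" where
  "ballot h 0 = 1"
| "ballot 0 (Suc r) = 0"
| "ballot (Suc h) (Suc r) = ballot h (Suc r) + ballot (h + 2) r"
  by pat_completeness auto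
termination by (relation "measures [snd, fst]") auto

text \<open>This is the closed form \<open>h / (h + 2 * r) * ((h + 2 * r) choose r)\<close> of
  \<open>ballot h r\<close> without denominators; its factor \<open>h\<close> later becomes
  \<open>n + 1\<close>.\<close>

lemma fact_ballot:
  "fact (Suc r) * ballot h (Suc r) = int h * pochhammer (int (h + r + 2)) r"
proof (induction r arbitrary: h)
  case 0
  then show ?case by (induction h) auto
next
  case (Suc r)
  note IH_r = Suc.IH
  show ?case
  proof (induction h)
    case (Suc h)
    \<comment> \<open>\<open>Q\<close> is the product shared by all three Pochhammer
      symbols.\<close>
    define Q where "Q = pochhammer (int (h + r + 4)) r"
    have "fact (Suc (Suc r)) * ballot (Suc h) (Suc (Suc r)) =
        fact (Suc (Suc r)) * ballot h (Suc (Suc r)) +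
        int (r + 2) * (fact (Suc r) * ballot (h + 2) (Suc r))"
      by (simp add: algebra_simps)
    also have "\<dots> = int h * pochhammer (int (h + Suc r + 2)) (Suc r) +
        int (r + 2) * (int (h + 2) * Q)"
      unfolding Suc.IH IH_r Q_def by (simp add: algebra_simps)
    also have "pochhammer (int (h + Suc r + 2)) (Suc r) = int (h + r + 3) * Q"
      by (simp add: pochhammer_rec Q_def algebra_simps)
    also have "int h * (int (h + r + 3) * Q) + int (r + 2) * (int (h + 2) * Q) =
        int (Suc h) * (int (h + 2 * r + 4) * Q)"
      by (simp add: algebra_simps)
    also have "int (h + 2 * r + 4) * Q = pochhammer (int (Suc h + Suc r + 2)) (Suc r)"
      by (simp add: pochhammer_rec' Q_def algebra_simps)
    finally show ?case .
  qed simp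
qed

text \<open>This counts paths from column -1 with \<open>r\<close> leftward steps and rise
  \<open>z\<close> that never return to that column: \<open>ballot\<close> counts the horizontal
  projections, and the binomial selects the steps that are North-East or West.\<close>

definition half_plane_sol :: "nat \<Rightarrow> nat \<Rightarrow> int \<Rightarrow> int" where
  "half_plane_sol r h z = ballot h r * zchoose (h + 2 * r) (int r + z)"

lemma half_plane_sol_zero:
  "half_plane_sol 0 (Suc h) z = half_plane_sol 0 h z + half_plane_sol 0 h (z - 1)"
  by (simp add: half_plane_sol_def zchoose_Suc)

text \<open>Pascal's rule splits the binomial in the same way for both summands of the ballot
  recurrence.\<close>

lemma half_plane_sol_Suc:
  "half_plane_sol (Suc r) (Suc h) z = half_plane_sol (Suc r) h z + half_plane_sol (Suc r) h (z - 1)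
    + half_plane_sol r (h + 2) z + half_plane_sol r (h + 2) (z + 1)"
proof -
  have "zchoose (Suc h + 2 * Suc r) (int (Suc r) + z) =
      zchoose (h + 2 + 2 * r) (int r + z + 1) + zchoose (h + 2 + 2 * r) (int r + z)"
    using zchoose_Suc[of "h + 2 + 2 * r" "int r + z + 1"] by (simp add: algebra_simps)
  then show ?thesis by (simp add: half_plane_sol_def algebra_simps)
qed

text \<open>With \<open>h = n + 1\<close>, the solution \<open>main_term\<close> starts from the origin at \<open>n = 0\<close>, while
  \<open>half_plane_sol\<close> starts from a source in the column \<open>n = -1\<close>.\<close>

definition main_term :: "nat \<Rightarrow> nat \<Rightarrow> int \<Rightarrow> int" where
  "main_term k h j = ballot h k * zchoose (h + 2 * k - 1) (int k + j)"

lemma main_term_Suc: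
  "main_term (Suc k) (Suc h) j = main_term (Suc k) h j + main_term (Suc k) h (j - 1)
    + main_term k (h + 2) j + main_term k (h + 2) (j + 1)"
proof -
  have "zchoose (Suc h + 2 * Suc k - 1) (int (Suc k) + j) =
      zchoose (h + 1 + 2 * k) (int k + j + 1) + zchoose (h + 1 + 2 * k) (int k + j)"
    using zchoose_Suc[of "h + 1 + 2 * k" "int k + j + 1"] by (simp add: algebra_simps)
  then show ?thesis by (simp add: main_term_def algebra_simps)
qed

text \<open>The endpoint is the mirror image of \<open>(-1, -i)\<close>.\<close>

definition source :: "nat \<Rightarrow> nat \<Rightarrow> int" where
  "source s i = int (F (2 * s - 1) (2 * int i - 3) (int i - 2))"

text \<open>A source at \<open>(-1, -i)\<close> at time \<open>2 * s - 1\<close> leaves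
  \<open>h + 2 * (k - s)\<close> steps and a rise of \<open>i + j\<close>.\<close>

definition boundary_term :: "nat \<Rightarrow> nat \<Rightarrow> int \<Rightarrow> int" where
  "boundary_term k h j =
    (\<Sum>s=1..k. \<Sum>i=2..s+1. source s i * half_plane_sol (k - s) h (int i + j))"

lemma boundary_term_Suc:
  "boundary_term (Suc k) (Suc h) j = boundary_term (Suc k) h j + boundary_term (Suc k) h (j - 1)
    + boundary_term k (h + 2) j + boundary_term k (h + 2) (j + 1)"
proof -
  define U where "U r h s j = (\<Sum>i=2..s+1. source s i * half_plane_sol r h (int i + j))" for r h s j
  \<comment> \<open>The newest source \<open>s = Suc k\<close> is absent from
    \<open>boundary_term k\<close>; with \<open>r = 0\<close> the two-term recurrence
    suffices.\<close>
  have last: "U 0 (Suc h) s j = U 0 h s j + U 0 h s (j - 1)" for s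
    unfolding U_def sum.distrib[symmetric]
    by (intro sum.cong refl) (simp add: half_plane_sol_zero algebra_simps)
  have "U (Suc r) (Suc h) s j = U (Suc r) h s j + U (Suc r) h s (j - 1)
      + U r (h + 2) s j + U r (h + 2) s (j + 1)" for r s
    unfolding U_def sum.distrib[symmetric]
    by (intro sum.cong refl) (simp add: half_plane_sol_Suc algebra_simps)
  then have "U (Suc k - s) (Suc h) s j = U (Suc k - s) h s j + U (Suc k - s) h s (j - 1)
      + U (k - s) (h + 2) s j + U (k - s) (h + 2) s (j + 1)" if "s \<in> {1..k}" for s
    using that by (simp add: Suc_diff_le)
  then have "(\<Sum>s=1..k. U (Suc k - s) (Suc h) s j) =
      (\<Sum>s=1..k. U (Suc k - s) h s j) + (\<Sum>s=1..k. U (Suc k - s) h s (j - 1))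
      + (\<Sum>s=1..k. U (k - s) (h + 2) s j) + (\<Sum>s=1..k. U (k - s) (h + 2) s (j + 1))"
    unfolding sum.distrib[symmetric] by (rule sum.cong[OF refl])
  moreover have "boundary_term k h j = (\<Sum>s=1..k. U (k - s) h s j)" for k h j
    by (simp only: boundary_term_def U_def)
  ultimately show ?thesis using last[of "Suc k"] by simp
qed

lemma boundary_term_column:
  "boundary_term (Suc k) 0 j = int (F (2 * k + 1) (- 3 - 2 * j) (- j - 2))"
proof -
  have sol: "half_plane_sol r 0 z = (if r = 0 \<and> z = 0 then 1 else 0)" for r z
    by (cases r) (auto simp: half_plane_sol_def zchoose_zero)
  have "boundary_term (Suc k) 0 j =
      (\<Sum>s=1..Suc k. if s = Suc k then \<Sum>i=2..s+1. source s i * half_plane_sol 0 0 (int i + j) else 0)"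
    unfolding boundary_term_def
    by (intro sum.cong refl) (auto simp: sol intro!: sum.neutral)
  also have "\<dots> = (\<Sum>i=2..k+2. source (Suc k) i * half_plane_sol 0 0 (int i + j))"
    by simp
  also have "\<dots> = (\<Sum>i=2..k+2. if i = nat (- j) then source (Suc k) i else 0)"
    by (intro sum.cong refl) (auto simp: sol)
  also have "\<dots> = (if nat (- j) \<in> {2..k+2} then source (Suc k) (nat (- j)) else 0)"
    by simp
  also have "\<dots> = int (F (2 * k + 1) (- 3 - 2 * j) (- j - 2))"
  proof (cases "nat (- j) \<in> {2..k+2}")
    case True
    then have "2 * int (nat (- j)) - 3 = - 3 - 2 * j" "int (nat (- j)) - 2 = - j - 2"
      "2 * Suc k - 1 = 2 * k + 1"
      by auto
    with True show ?thesis by (simp only: source_def if_True)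
  next
    case False
    then have "F (2 * k + 1) (- 3 - 2 * j) (- j - 2) = 0"
      \<comment> \<open>With \<open>i = -j\<close>, either \<open>i < 2\<close> and the row is
        negative, or \<open>i > k + 2\<close> and column \<open>2 * i - 3\<close> is out of
        reach.\<close>
      by (cases "- j < 2") (auto intro: F_outside F_far)
    with False show ?thesis by (simp only: if_False)
  qed
  finally show ?thesis .
qed

text \<open>Both sides satisfy one recurrence and agree on the diagonal \<open>k = 0\<close> and the
  column \<open>h = 0\<close>. The step to \<open>(Suc k, Suc h)\<close> uses
  \<open>(Suc k, h)\<close> and \<open>(k, h + 2)\<close>, hence the nested induction. The
  assumption excludes time -1.\<close>

lemma D_explicit:
  assumes "0 < k \<or> 0 < h"
  shows "D (h + 2 * k - 1) (int h - 1) j = main_term k h j - boundary_term k h j"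
  using assms
proof (induction k arbitrary: h j)
  case 0
  then obtain h' where "h = Suc h'" by (cases h) auto
  then show ?case by (simp add: D_diagonal main_term_def boundary_term_def)
next
  case (Suc k)
  note IH_k = Suc.IH
  show ?case
  proof (induction h arbitrary: j)
    case 0
    have "D (2 * k + 1) (- 1) j = - boundary_term (Suc k) 0 j"
      unfolding boundary_term_column by (simp add: D_def F_outside algebra_simps)
    then show ?case by (simp add: main_term_def)
  next
    case (Suc h)
    have k: "D (h + 2 * k + 1) (int h + 1) i = main_term k (h + 2) i - boundary_term k (h + 2) i" for i
      using IH_k[of "h + 2" i] by (simp add: add.commute)
    have h: "D (h + 2 * k + 1) (int h - 1) i =
        main_term (Suc k) h i - boundary_term (Suc k) h i" for i
      using Suc.IH[of i] by simp
    have "D (Suc (h + 2 * k + 1)) (int h) j = main_term (Suc k) (Suc h) j - boundary_term (Suc k) (Suc h) j"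
      unfolding D_Suc[OF of_nat_0_le_iff] k h main_term_Suc boundary_term_Suc by simp
    then show ?case by simp
  qed
qed

lemma F_explicit:
  assumes "0 < k"
  shows "int (F (n + 2 * k) (int n) 0) =
    ballot (n + 1) k * int ((n + 2 * k) choose k) -
    (\<Sum>s=1..k. \<Sum>i=2..s+1. source s i *
      (ballot (n + 1) (k - s) * int ((n + 1 + 2 * (k - s)) choose (k - s + i))))"
proof -
  have "half_plane_sol r h (int i + 0) = ballot h r * int ((h + 2 * r) choose (r + i))" for r h i
    by (simp add: half_plane_sol_def zchoose_of_nat flip: of_nat_add)
  then have "boundary_term k (n + 1) 0 = (\<Sum>s=1..k. \<Sum>i=2..s+1. source s i *
      (ballot (n + 1) (k - s) * int ((n + 1 + 2 * (k - s)) choose (k - s + i))))"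
    by (simp only: boundary_term_def)
  moreover have "main_term k (n + 1) 0 = ballot (n + 1) k * int ((n + 2 * k) choose k)"
    by (simp add: main_term_def zchoose_of_nat)
  moreover have "int (F (n + 2 * k) (int n) 0) = D (n + 1 + 2 * k - 1) (int (n + 1) - 1) 0"
    by (simp add: D_def F_outside)
  ultimately show ?thesis
    using D_explicit[of k "n + 1" 0] assms by simp
qed

section \<open>Clearing denominators: integer polynomials for the single terms\<close>

text \<open>For \<open>N < i\<close> the product contains the factor 0, so polynomiality holds down
  to \<open>n = 0\<close>.\<close>

lemma fact_binomial_pochhammer:
  "fact i * int (N choose i) = pochhammer (int N - int i + 1) i"
proof -
  have "of_int (fact i * int (N choose i)) = (of_int (pochhammer (int N - int i + 1) i) :: rat)"
    by (simp add: binomial_gbinomial gbinomial_pochhammer' flip: pochhammer_of_int)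
  then show ?thesis by linarith
qed

lemma poly_pochhammer: "poly (pochhammer q i) x = pochhammer (poly q x) i"
  by (simp add: pochhammer_prod poly_prod)

lemma monic_mult:
  fixes p q :: "int poly"
  assumes "lead_coeff p = 1" "lead_coeff q = 1"
  shows "degree (p * q) = degree p + degree q" "lead_coeff (p * q) = 1"
proof -
  have "p \<noteq> 0" "q \<noteq> 0" using assms by auto
  then show "degree (p * q) = degree p + degree q" by (rule degree_mult_eq)
  show "lead_coeff (p * q) = 1" using assms by (simp add: lead_coeff_mult)
qed

lemma pochhammer_linear:
  fixes a :: int
  shows "degree (pochhammer [:a, 1:] i) = i" "lead_coeff (pochhammer [:a, 1:] i) = 1"
proof -
  have *: "degree (pochhammer [:a, 1:] i) = i \<and> lead_coeff (pochhammer [:a, 1:] i) = 1"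
  proof (induction i)
    case (Suc i)
    have eq: "pochhammer [:a, 1:] (Suc i) = pochhammer [:a, 1:] i * [:a + int i, 1:]"
      by (simp add: pochhammer_Suc of_nat_poly)
    have "lead_coeff [:a + int i, 1:] = 1" by simp
    from monic_mult[OF conjunct2[OF Suc.IH] this] conjunct1[OF Suc.IH]
    show ?case unfolding eq by (intro conjI) (simp_all only:, simp)
  qed simp
  show "degree (pochhammer [:a, 1:] i) = i" "lead_coeff (pochhammer [:a, 1:] i) = 1"
    using * by auto
qed

definition main_poly :: "nat \<Rightarrow> int poly" where
  "main_poly k = pochhammer [:int k + 2, 1:] (k - 1) * pochhammer [:int k + 1, 1:] k"

text \<open>For \<open>r = 0\<close> the ballot number is 1, so the factor \<open>n + 1\<close> is
  taken from the binomial instead, which shortens its product to \<open>i - 1\<close>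
  factors.\<close>

definition boundary_poly :: "nat \<Rightarrow> nat \<Rightarrow> int poly" where
  "boundary_poly r i =
    (if r = 0 then pochhammer [:2 - int i, 1:] (i - 1)
     else pochhammer [:int r + 2, 1:] (r - 1) * pochhammer [:int r + 2 - int i, 1:] (r + i))"

lemma main_poly_monic:
  assumes "0 < k"
  shows "degree (main_poly k) = 2 * k - 1" "lead_coeff (main_poly k) = 1"
proof -
  note monic = monic_mult[OF pochhammer_linear(2) pochhammer_linear(2)]
  show "degree (main_poly k) = 2 * k - 1"
    unfolding main_poly_def monic(1) pochhammer_linear(1) using assms by simp
  show "lead_coeff (main_poly k) = 1"
    unfolding main_poly_def by (rule monic(2))
qed

lemma boundary_poly_monic:
  assumes "0 < i"
  shows "degree (boundary_poly r i) = 2 * r + i - 1" "lead_coeff (boundary_poly r i) = 1"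
proof -
  note monic = monic_mult[OF pochhammer_linear(2) pochhammer_linear(2)]
  show "degree (boundary_poly r i) = 2 * r + i - 1"
    unfolding boundary_poly_def if_distrib[of degree] monic(1) pochhammer_linear(1)
    using assms by auto
  show "lead_coeff (boundary_poly r i) = 1"
    unfolding boundary_poly_def if_distrib[of lead_coeff] monic(2) pochhammer_linear(2) by simp
qed

lemma main_poly_eval:
  assumes "0 < k"
  shows "fact k * fact k * (ballot (n + 1) k * int ((n + 2 * k) choose k)) =
    (int n + 1) * poly (main_poly k) (int n)"
proof -
  obtain r where r: "k = Suc r" using assms by (cases k) auto
  have "fact k * fact k * (ballot (n + 1) k * int ((n + 2 * k) choose k)) =
      (fact k * ballot (n + 1) k) * (fact k * int ((n + 2 * k) choose k))"
    by (simp only: mult_ac)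
  also have "\<dots> = (int n + 1) * poly (main_poly k) (int n)"
    unfolding r fact_ballot fact_binomial_pochhammer
    by (simp add: main_poly_def poly_pochhammer algebra_simps)
  finally show ?thesis .
qed

lemma boundary_poly_eval:
  assumes "0 < i"
  shows "fact r * fact (r + i) * (ballot (n + 1) r * int ((n + 1 + 2 * r) choose (r + i))) =
    (int n + 1) * poly (boundary_poly r i) (int n)"
proof (cases r)
  case 0
  obtain l where l: "i = Suc l" using assms by (cases i) auto
  show ?thesis
    using fact_binomial_pochhammer[of i "n + 1"] 0
    by (simp add: l boundary_poly_def poly_pochhammer pochhammer_rec' algebra_simps)
next
  case (Suc l)
  have "fact r * fact (r + i) * (ballot (n + 1) r * int ((n + 1 + 2 * r) choose (r + i))) =
      (fact r * ballot (n + 1) r) * (fact (r + i) * int ((n + 1 + 2 * r) choose (r + i)))"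
    by (simp only: mult_ac)
  also have "\<dots> = (int n + 1) * poly (boundary_poly r i) (int n)"
    unfolding Suc fact_ballot fact_binomial_pochhammer
    by (simp add: boundary_poly_def poly_pochhammer algebra_simps)
  finally show ?thesis .
qed

section \<open>Assembling the polynomial: integrality and leading term\<close>

text \<open>Both quotients are exact for \<open>s\<close> in \<open>{1..k}\<close> and
  \<open>i\<close> in \<open>{2..s+1}\<close>, since then
  \<open>k - s + i \<le> k + 1\<close>.\<close>

definition weight :: "nat \<Rightarrow> nat \<Rightarrow> nat \<Rightarrow> int" where
  "weight k s i = source s i * (fact k div fact (k - s)) * (fact (k + 1) div fact (k - s + i))"

definition gessel_poly :: "nat \<Rightarrow> int poly" where
  "gessel_poly k = smult (int k + 1) (main_poly k) -
    (\<Sum>s=1..k. \<Sum>i=2..s+1. smult (weight k s i) (boundary_poly (k - s) i))"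

lemma gessel_poly_eval:
  assumes "0 < k"
  shows "fact k * fact (k + 1) * int (F (n + 2 * k) (int n) 0) =
    (int n + 1) * poly (gessel_poly k) (int n)"
proof -
  have main: "fact k * fact (k + 1) * (ballot (n + 1) k * int ((n + 2 * k) choose k)) =
      (int n + 1) * poly (smult (int k + 1) (main_poly k)) (int n)"
    using arg_cong[OF main_poly_eval[OF assms, of n], of "(*) (int k + 1)"]
    by (simp add: algebra_simps)
  have boundary: "fact k * fact (k + 1) * (source s i *
        (ballot (n + 1) (k - s) * int ((n + 1 + 2 * (k - s)) choose (k - s + i)))) =
      (int n + 1) * poly (smult (weight k s i) (boundary_poly (k - s) i)) (int n)"
    if "s \<in> {1..k}" "i \<in> {2..s+1}" for s i
  proof -
    have 1: "fact k = (fact k div fact (k - s)) * (fact (k - s) :: int)"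
      by (simp add: fact_dvd)
    have 2: "fact (k + 1) = (fact (k + 1) div fact (k - s + i)) * (fact (k - s + i) :: int)"
      using that by (intro dvd_div_mult_self[symmetric] fact_dvd) auto
    have "fact k * fact (k + 1) * (source s i *
        (ballot (n + 1) (k - s) * int ((n + 1 + 2 * (k - s)) choose (k - s + i)))) =
      weight k s i * (fact (k - s) * fact (k - s + i) *
        (ballot (n + 1) (k - s) * int ((n + 1 + 2 * (k - s)) choose (k - s + i))))"
      by (subst 1, subst 2) (simp only: weight_def mult_ac)
    also have "\<dots> = weight k s i * ((int n + 1) * poly (boundary_poly (k - s) i) (int n))"
      using that by (subst boundary_poly_eval) auto
    finally show ?thesis by (simp add: mult_ac)
  qed
  show ?thesis
    unfolding F_explicit[OF assms] gessel_poly_def right_diff_distrib main poly_diff poly_sum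
      sum_distrib_left
    by (intro arg_cong2[of _ _ _ _ minus] sum.cong refl boundary)
qed

lemma source_one: "source 1 2 = 1"
proof -
  have "F (Suc 0) 1 0 = 1" by (subst F_Suc) (simp_all add: F_zero)
  then show ?thesis by (simp add: source_def)
qed

lemma gessel_poly_monic:
  assumes "0 < k"
  shows "degree (gessel_poly k) = 2 * k - 1" "lead_coeff (gessel_poly k) = 1"
proof -
  \<comment> \<open>The degree \<open>2 * (k - s) + i - 1\<close> is largest at
    \<open>i = s + 1\<close>, so only \<open>s = 1\<close>, \<open>i = 2\<close> can reach
    \<open>2 * k - 1\<close>.\<close>
  have deg_term: "degree (smult (weight k s i) (boundary_poly (k - s) i)) \<le> 2 * k - s"
    if "s \<in> {1..k}" "i \<in> {2..s+1}" for s i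
    using that boundary_poly_monic(1)[of i "k - s"] by (intro order.trans[OF degree_smult_le]) auto
  have le: "degree (gessel_poly k) \<le> 2 * k - 1"
    unfolding gessel_poly_def
  proof (intro degree_diff_le degree_sum_le)
    show "degree (smult (int k + 1) (main_poly k)) \<le> 2 * k - 1"
      using degree_smult_le[of "int k + 1" "main_poly k"] main_poly_monic(1)[OF assms] by simp
    show "degree (smult (weight k s i) (boundary_poly (k - s) i)) \<le> 2 * k - 1"
      if "s \<in> {1..k}" "i \<in> {2..s+1}" for s i
      using deg_term[OF that] that by auto
  qed auto
  have high: "(\<Sum>i=2..s+1. coeff (smult (weight k s i) (boundary_poly (k - s) i)) (2 * k - 1)) = 0"
    if "s \<in> {1..k} - {1}" for s
    using that deg_term[of s] by (intro sum.neutral ballI coeff_eq_0) fastforce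
  have "coeff (\<Sum>s=1..k. \<Sum>i=2..s+1. smult (weight k s i) (boundary_poly (k - s) i)) (2 * k - 1) =
      (\<Sum>s=1..k. \<Sum>i=2..s+1. coeff (smult (weight k s i) (boundary_poly (k - s) i)) (2 * k - 1))"
    by (simp only: coeff_sum)
  also have "\<dots> = (\<Sum>i=2..1+1. coeff (smult (weight k 1 i) (boundary_poly (k - 1) i)) (2 * k - 1))"
    using assms high by (subst sum.remove[of _ 1]) (auto simp del: coeff_smult)
  also have "\<dots> = weight k 1 2 * coeff (boundary_poly (k - 1) 2) (2 * k - 1)"
    by (simp add: numeral_2_eq_2)
  also have "coeff (boundary_poly (k - 1) 2) (2 * k - 1) = 1"
  proof -
    have "2 * (k - 1) + 2 - 1 = 2 * k - 1" using assms by simp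
    then show ?thesis using boundary_poly_monic[of 2 "k - 1"] by (simp only: zero_less_numeral)
  qed
  \<comment> \<open>The first quotient is \<open>k\<close>, the second is 1, and the source is a
    single East step.\<close>
  also have "weight k 1 2 = int k"
    using source_one assms by (cases k) (simp_all add: weight_def)
  finally have "coeff (gessel_poly k) (2 * k - 1) = 1"
    using main_poly_monic[OF assms] by (simp add: gessel_poly_def)
  moreover from this have "2 * k - 1 \<le> degree (gessel_poly k)"
    by (intro le_degree) simp
  ultimately show "degree (gessel_poly k) = 2 * k - 1" "lead_coeff (gessel_poly k) = 1"
    using le by auto
qed

theorem mainTheorem8:
  fixes k :: nat
  assumes "k \<ge> 1"
  shows "\<exists>p :: int poly. degree p = 2 * k - 1 \<and> lead_coeff p = 1 \<and>
           (\<forall>n :: nat. (fact k * fact (k + 1) / (of_nat n + 1)) * of_nat (F (n + 2 * k) (int n) 0)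
                       = (of_int (poly p (int n)) :: rat))"
proof (intro exI conjI allI)
  have k: "0 < k" using assms by simp
  show "degree (gessel_poly k) = 2 * k - 1" "lead_coeff (gessel_poly k) = 1"
    using gessel_poly_monic[OF k] .
  fix n :: nat
  have "of_int (fact k * fact (k + 1) * int (F (n + 2 * k) (int n) 0)) =
      (of_int ((int n + 1) * poly (gessel_poly k) (int n)) :: rat)"
    by (simp only: gessel_poly_eval[OF k])
  then have "fact k * fact (k + 1) * of_nat (F (n + 2 * k) (int n) 0) =
      (of_nat n + 1) * (of_int (poly (gessel_poly k) (int n)) :: rat)"
    by (simp only: of_int_mult of_int_fact of_int_of_nat_eq of_int_add of_int_1)
  moreover have "of_nat n + 1 \<noteq> (0 :: rat)"
    by (metis of_nat_Suc of_nat_neq_0 add.commute)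
  ultimately show "(fact k * fact (k + 1) / (of_nat n + 1)) * of_nat (F (n + 2 * k) (int n) 0)
      = (of_int (poly (gessel_poly k) (int n)) :: rat)"
    by (simp only: times_divide_eq_left nonzero_mult_div_cancel_left simp_thms)
qed

end
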